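(* The displacement-enumerator of prime parking functions is \[ \mathrm{PPF}_{n+1}(q)=(n+1)! ~~q^n \sum_{\substack{\text{all possible}\\\text{Łukasiewicz paths with} \\ \text{height sequence } \\ (h_0, h_1, \dots, h_n)}} \frac{1}{h_1-h_0+2} ~~\prod_{j=1}^{n} \frac{q^{h_{j}}}{(h_{j}-h_{j-1}+1)!}, \] where $\frac{q^{h_{j}}}{(h_{j}-h_{j-1}+1)!}$ denotes the weight of a step $h_{j-1} \rightarrow h_{j}$ with $h_{j} \geq h_{j-1}-1$ in the Łukasiewicz path.
   Context: A (classical) parking function of length $n$ is a sequence $\pi=(\pi_1,\dots,\pi_n)$ of positive integers whose increasing rearrangement $\lambda_1\le\cdots\le\lambda_n$ satisfies $\lambda_i\le i$. A parking function of length $n+1$ is prime if removing any instance of 1 yields a parking function of length $n$; $\mathrm{PPF}_{n+1}$ denotes this set, and $\mathrm{PPF}_{n+1}(q)=\sum_{\pi\in\mathrm{PPF}_{n+1}} q^{\text{dis}(\pi)}$, where $\text{dis}(\pi)=\frac{m(m+1)}{2}-\sum_i\pi_i$ for $\pi$ of length $m$. A Łukasiewicz word of length $n$ is a sequence $(\ell_1,\dots,\ell_n)$ of integers $\ell_i\ge -1$ with all partial sums $\sum_{i\le k}\ell_i\ge 0$ and $\sum_{i=1}^n\ell_i=0$; the Łukasiewicz path represents $\ell_i$ by the step $(\ell_i+1,\ell_i)$, going from $(0,0)$ to $(n,0)$ without going below the $x$-axis. Its height sequence is $(h_0,\dots,h_n)$ with $h_0=h_n=0$ and $h_j=\sum_{i=1}^j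 \ell_i$. (The sum is over Łukasiewicz paths of length $n$.) *)

theory Defs
  imports Complex_Main "HOL-Library.Multiset"
begin

definition parking_function :: "nat \<Rightarrow> nat list \<Rightarrow> bool" where
  "parking_function m \<pi> \<longleftrightarrow>
     length \<pi> = m \<and> (\<forall>x\<in>set \<pi>. 0 < x) \<and> (\<forall>i<m. sort \<pi> ! i \<le> Suc i)"

definition prime_parking_function :: "nat \<Rightarrow> nat list \<Rightarrow> bool" where
  "prime_parking_function m \<pi> \<longleftrightarrow>
     0 < m \<and> parking_function m \<pi> \<and>
     (\<forall>i<m. \<pi> ! i = 1 \<longrightarrow> parking_function (m - 1) (take i \<pi> @ drop (Suc i) \<pi>))"

definition PPF :: "nat \<Rightarrow> nat list set" where
  "PPF m = {\<pi>. prime_parking_function m \<pi>}"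

(* The subtraction does not truncate on parking functions: see the lemma below. *)
definition dis :: "nat list \<Rightarrow> nat" where
  "dis \<pi> = length \<pi> * (length \<pi> + 1) div 2 - sum_list \<pi>"

lemma parking_function_sum_list_le:
  assumes "parking_function m \<pi>"
  shows "sum_list \<pi> \<le> m * (m + 1) div 2"
proof -
  have "sum_list \<pi> = sum_list (sort \<pi>)"
    by (metis mset_sort sum_mset_sum_list)
  also have "\<dots> = (\<Sum>i<m. sort \<pi> ! i)"
    using assms by (simp add: parking_function_def sum_list_sum_nth atLeast0LessThan)
  also have "\<dots> \<le> (\<Sum>i<m. Suc i)"
    using assms by (intro sum_mono) (auto simp: parking_function_def)
  also have "\<dots> = m * (m + 1) div 2"
    by (induction m) auto
  finally show ?thesis .
qed

definition PPF_enum :: "nat \<Rightarrow> 'a::field_char_0 \<Rightarrow> 'a" where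
  "PPF_enum m q = (\<Sum>\<pi>\<in>PPF m. q ^ dis \<pi>)"

definition luk_words :: "nat \<Rightarrow> int list set" where
  "luk_words n = {l. length l = n \<and> (\<forall>x\<in>set l. - 1 \<le> x) \<and>
                     (\<forall>k\<le>n. 0 \<le> sum_list (take k l)) \<and> sum_list l = 0}"

(* A path is the list of its steps in the plane. *)
definition luk_path :: "int list \<Rightarrow> (int \<times> int) list" where
  "luk_path l = map (\<lambda>x. (x + 1, x)) l"

definition luk_paths :: "nat \<Rightarrow> (int \<times> int) list set" where
  "luk_paths n = luk_path ` luk_words n"

definition height :: "(int \<times> int) list \<Rightarrow> nat \<Rightarrow> int" where
  "height p j = sum_list (map snd (take j p))"

lemma height_luk_path: "height (luk_path l) j = sum_list (take j l)"
  by (simp add: height_def luk_path_def take_map o_def)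

(* Weight of a step from height a to height b. On Lukasiewicz paths 0 \<le> b and
   a - 1 \<le> b, so neither use of nat truncates. *)
definition step_weight :: "'a::field_char_0 \<Rightarrow> int \<Rightarrow> int \<Rightarrow> 'a" where
  "step_weight q a b = q ^ nat b / fact (nat (b - a + 1))"

end

theory Submission
  imports Defs "HOL-Combinatorics.Multiset_Permutations"
begin

text \<open>
  A list of length n + 1 is a prime parking function iff its entries lie in {1..n} and at least
  k + 1 of them are at most k, for 1 \<le> k \<le> n. If c_j is the number of entries equal to j, then
  l_1 = c_1 - 2 and l_j = c_j - 1 for j \<ge> 2 define a Lukasiewicz word whose height at k is
  the excess of that count over k + 1; every such word arises from exactly one content.
  A content has (n + 1)! / (c_1! ... c_n!) arrangements, where c_1! = (l_1 + 2) (l_1 + 1)! accounts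
  for the extra factor at the first step, and summing the heights gives the displacement minus n.
\<close>

section \<open>Parking functions described by their content\<close>

definition count_upto :: "nat multiset \<Rightarrow> nat \<Rightarrow> nat" where
  "count_upto M k = size (filter_mset (\<lambda>x. x \<le> k) M)"

text \<open>In a sorted list the entries at most \<open>t\<close> form an initial segment, so an
  index belongs to it exactly when it is smaller than the length of that segment.\<close>

lemma sorted_nth_le_iff_length_filter:
  fixes xs :: "'a::linorder list"
  assumes "sorted xs" "i < length xs"
  shows "xs ! i \<le> t \<longleftrightarrow> i < length (filter (\<lambda>x. x \<le> t) xs)"
  using assms
proof (induction xs arbitrary: i)
  case (Cons a xs)
  show ?case
  proof (cases "a \<le> t")
    case True
    then show ?thesis using Cons by (cases i) auto
  next
    case False
    then have "\<forall>x\<in>set (a # xs). \<not> x \<le> t" using Cons.prems by auto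
    moreover from this have "filter (\<lambda>x. x \<le> t) (a # xs) = []" by (simp add: filter_empty_conv)
    moreover have "(a # xs) ! i \<in> set (a # xs)" using Cons.prems(2) by (rule nth_mem)
    ultimately show ?thesis by (metis list.size(3) not_less_zero)
  qed
qed simp

text \<open>Replaces the sorted list by counts, so that the condition visibly depends only on the
  content and all arrangements can be treated together.\<close>

lemma parking_function_iff_count_upto:
  "parking_function m \<pi> \<longleftrightarrow>
     size (mset \<pi>) = m \<and> 0 \<notin># mset \<pi> \<and> (\<forall>k\<in>{1..m}. k \<le> count_upto (mset \<pi>) k)"
proof -
  have "sort \<pi> ! i \<le> Suc i \<longleftrightarrow> Suc i \<le> count_upto (mset \<pi>) (Suc i)" if "i < length \<pi>" for i
  proof -
    have "length (filter (\<lambda>x. x \<le> Suc i) (sort \<pi>)) = count_upto (mset \<pi>) (Suc i)"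
      unfolding count_upto_def by (metis mset_filter mset_sort size_mset)
    then show ?thesis
      using sorted_nth_le_iff_length_filter[of "sort \<pi>" i "Suc i"] that by (simp add: Suc_le_eq)
  qed
  moreover have "(\<forall>k\<in>{1..m}. P k) \<longleftrightarrow> (\<forall>i<m. P (Suc i))" for P
    unfolding image_Suc_lessThan[symmetric] by auto
  ultimately show ?thesis
    unfolding parking_function_def by (auto intro: gr0I)
qed

section \<open>Contents of prime parking functions\<close>

definition prime_contents :: "nat \<Rightarrow> nat multiset set" where
  "prime_contents n = {M. size M = n + 1 \<and> set_mset M \<subseteq> {1..n} \<and>
                          (\<forall>k\<in>{1..n}. k + 1 \<le> count_upto M k)}"

lemma mset_remove_nth:
  assumes "i < length xs"
  shows "mset (take i xs @ drop (Suc i) xs) = mset xs - {#xs ! i#}"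
proof -
  have "mset xs = mset (take i xs @ xs ! i # drop (Suc i) xs)"
    using id_take_nth_drop[OF assms] by simp
  then show ?thesis by simp
qed

lemma count_upto_diff_one:
  assumes "1 \<in># M" "1 \<le> k"
  shows "count_upto M k = Suc (count_upto (M - {#1#}) k)"
proof -
  obtain N where "M = add_mset 1 N" using assms(1) by (meson multi_member_split)
  then show ?thesis using assms(2) by (simp add: count_upto_def)
qed

lemma count_upto_le_size: "count_upto M k \<le> size M"
  unfolding count_upto_def by simp

lemma count_upto_eq_size_iff: "count_upto M k = size M \<longleftrightarrow> (\<forall>x\<in>#M. x \<le> k)"
proof
  assume "count_upto M k = size M"
  then have "filter_mset (\<lambda>x. x \<le> k) M = M"
    unfolding count_upto_def
    by (metis mset_subset_size multiset_filter_subset nat_less_le subset_mset.le_neq_trans)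
  then show "\<forall>x\<in>#M. x \<le> k" by (metis filter_mset_eq_conv)
next
  assume "\<forall>x\<in>#M. x \<le> k"
  then have "filter_mset (\<lambda>x. x \<le> k) M = M" by (simp add: filter_mset_eq_conv)
  then show "count_upto M k = size M" by (simp add: count_upto_def)
qed

text \<open>Removing a 1 lowers each count with \<open>1 \<le> k\<close> by exactly one, which turns
  the bound \<open>k\<close> into \<open>k + 1\<close>. For \<open>n = 0\<close> the equivalence
  fails: \<open>[1]\<close> is prime, but \<open>prime_contents 0\<close> is empty.\<close>

lemma PPF_iff_prime_contents:
  assumes "1 \<le> n"
  shows "\<pi> \<in> PPF (n + 1) \<longleftrightarrow> mset \<pi> \<in> prime_contents n"
proof
  assume "\<pi> \<in> PPF (n + 1)"
  then have pf: "parking_function (n + 1) \<pi>"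
    and rem: "\<And>i. i < n + 1 \<Longrightarrow> \<pi> ! i = 1 \<Longrightarrow>
                parking_function n (take i \<pi> @ drop (Suc i) \<pi>)"
    by (auto simp: PPF_def prime_parking_function_def)
  then have pf': "size (mset \<pi>) = n + 1" "0 \<notin># mset \<pi>"
      "\<forall>k\<in>{1..n + 1}. k \<le> count_upto (mset \<pi>) k"
    unfolding parking_function_iff_count_upto by blast+
  \<comment> \<open>Primality says nothing in the absence of an entry 1, so one is produced first,
    from the parking condition at \<open>k = 1\<close>.\<close>
  have "1 \<le> count_upto (mset \<pi>) 1" using pf' by auto
  then have "filter_mset (\<lambda>x. x \<le> 1) (mset \<pi>) \<noteq> {#}" 
    unfolding count_upto_def by (metis not_one_le_zero size_empty)
  then obtain x where x: "x \<in># mset \<pi>" "x \<le> 1"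
    unfolding filter_mset_eq_mempty_iff by blast
  have "x \<noteq> 0" using pf'(2) x(1) by metis
  then have "x = 1" using x(2) by linarith
  then have one: "1 \<in># mset \<pi>" using x(1) by simp
  then obtain i where i: "i < length \<pi>" "\<pi> ! i = 1" by (auto simp: in_set_conv_nth)
  have "parking_function n (take i \<pi> @ drop (Suc i) \<pi>)" using rem i pf' by simp
  then have "\<forall>k\<in>{1..n}. k \<le> count_upto (mset \<pi> - {#1#}) k"
    unfolding parking_function_iff_count_upto mset_remove_nth[OF i(1)] i(2) by simp
  then have ge: "\<forall>k\<in>{1..n}. k + 1 \<le> count_upto (mset \<pi>) k"
    using count_upto_diff_one[OF one] by auto
  \<comment> \<open>At \<open>k = n\<close> the bound already equals the size \<open>n + 1\<close>,
    so no entry can be \<open>n + 1\<close>.\<close>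
  then have "count_upto (mset \<pi>) n = size (mset \<pi>)"
    using count_upto_le_size[of "mset \<pi>" n] pf'(1) assms by (intro antisym) auto
  then have "\<forall>x\<in>#mset \<pi>. x \<le> n" by (simp only: count_upto_eq_size_iff)
  then show "mset \<pi> \<in> prime_contents n"
    using ge pf' unfolding prime_contents_def
    by (auto simp: Suc_le_eq simp del: set_mset_mset intro!: gr0I)
next
  assume M: "mset \<pi> \<in> prime_contents n"
  then have le: "\<forall>x\<in>#mset \<pi>. x \<le> n + 1" by (auto simp: prime_contents_def)
  have pf: "parking_function (n + 1) \<pi>"
    unfolding parking_function_iff_count_upto
  proof (intro conjI ballI)
    fix k assume "k \<in> {1..n + 1}"
    then consider "k \<in> {1..n}" | "k = n + 1" by force
    then show "k \<le> count_upto (mset \<pi>) k"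
    proof cases
      case 1
      then have "k + 1 \<le> count_upto (mset \<pi>) k" using M unfolding prime_contents_def by blast
      then show ?thesis by simp
    next
      case 2
      have "count_upto (mset \<pi>) (n + 1) = size (mset \<pi>)"
        using le by (simp only: count_upto_eq_size_iff)
      then show ?thesis using 2 M by (simp add: prime_contents_def)
    qed
  qed (use M in \<open>auto simp: prime_contents_def\<close>)
  have "parking_function n (take i \<pi> @ drop (Suc i) \<pi>)" if "i < n + 1" "\<pi> ! i = 1" for i
  proof -
    have i: "i < length \<pi>" using that M by (simp add: prime_contents_def)
    then have one: "1 \<in># mset \<pi>" using that(2) by (metis nth_mem set_mset_mset)
    show ?thesis
      unfolding parking_function_iff_count_upto mset_remove_nth[OF i] that(2)
    proof (intro conjI ballI)
      show "size (mset \<pi> - {#1#}) = n"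
        using M one by (simp add: prime_contents_def size_Diff_singleton)
      show "0 \<notin># mset \<pi> - {#1#}"
        using M by (auto simp: prime_contents_def dest!: in_diffD)
      fix k assume k: "k \<in> {1..n}"
      then have "k + 1 \<le> count_upto (mset \<pi>) k" using M unfolding prime_contents_def by blast
      then show "k \<le> count_upto (mset \<pi> - {#1#}) k"
        using count_upto_diff_one[OF one, of k] k by simp
    qed
  qed
  then show "\<pi> \<in> PPF (n + 1)"
    using pf by (simp add: PPF_def prime_parking_function_def)
qed

section \<open>Summing multiplicities and counts\<close>

lemma sum_count_eq_count_upto:
  assumes "0 \<notin># M"
  shows "(\<Sum>j<k. count M (Suc j)) = count_upto M k"
proof (induction k)
  case 0
  have "filter_mset (\<lambda>x. x = 0) M = {#}" using assms by (auto intro: gr0I)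
  then show ?case by (simp add: count_upto_def)
next
  case (Suc k)
  have "filter_mset (\<lambda>x. x \<le> Suc k) M
      = filter_mset (\<lambda>x. x \<le> k) M + replicate_mset (count M (Suc k)) (Suc k)"
    by (rule multiset_eqI) auto
  then have "count_upto M (Suc k) = count_upto M k + count M (Suc k)"
    by (simp add: count_upto_def)
  then show ?case using Suc by simp
qed

text \<open>Double counting: an entry x in {1..n} is at most k for exactly n + 1 - x of the k in {1..n}.\<close>

lemma sum_mset_plus_sum_count_upto:
  assumes "set_mset M \<subseteq> {1..n}"
  shows "sum_mset M + (\<Sum>k=1..n. count_upto M k) = (n + 1) * size M"
  using assms
proof (induction M)
  case empty
  then show ?case by (simp add: count_upto_def)
next
  case (add x M)
  have "(\<Sum>k=1..n. count_upto (add_mset x M) k)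
      = (\<Sum>k=1..n. count_upto M k + (if x \<le> k then 1 else 0))"
    by (intro sum.cong) (auto simp: count_upto_def)
  also have "\<dots> = (\<Sum>k=1..n. count_upto M k) + card {x..n}"
  proof -
    have "{1..n} \<inter> {k. x \<le> k} = {x..n}" using add.prems by auto
    then show ?thesis by (simp add: sum.distrib sum.If_cases)
  qed
  finally show ?case using add by simp
qed

section \<open>Bijection between prime contents and Lukasiewicz words\<close>

definition content_word :: "nat \<Rightarrow> nat multiset \<Rightarrow> int list" where
  "content_word n M = map (\<lambda>j. int (count M (Suc j)) - (if j = 0 then 2 else 1)) [0..<n]"

text \<open>The intended inverse of \<open>content_word\<close>. On Lukasiewicz words
  \<open>nat\<close> does not truncate, since all letters are at least -1.\<close>

definition word_content :: "int list \<Rightarrow> nat multiset" where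
  "word_content l =
     (\<Sum>j<length l. replicate_mset (nat (l ! j + (if j = 0 then 2 else 1))) (Suc j))"

lemma length_content_word [simp]: "length (content_word n M) = n"
  by (simp add: content_word_def)

lemma content_word_nth:
  "j < n \<Longrightarrow> content_word n M ! j = int (count M (Suc j)) - (if j = 0 then 2 else 1)"
  by (simp add: content_word_def)

lemma count_word_content:
  "count (word_content l) x =
     (if 1 \<le> x \<and> x \<le> length l then nat (l ! (x - 1) + (if x = 1 then 2 else 1)) else 0)"
proof -
  \<comment> \<open>Only the summand at \<open>j = x - 1\<close> can contribute. The inner test on
    \<open>x\<close> excludes \<open>x = 0\<close>, where the truncated \<open>x - 1\<close> would
    select index 0.\<close>
  have "count (word_content l) x =
      (\<Sum>j<length l. if j = x - 1 then
         (if 1 \<le> x then nat (l ! j + (if j = 0 then 2 else 1)) else 0) else 0)"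
    unfolding word_content_def count_sum by (intro sum.cong) auto
  also have "\<dots> = (if x - 1 < length l then
       (if 1 \<le> x then nat (l ! (x - 1) + (if x - 1 = 0 then 2 else 1)) else 0) else 0)"
    by (subst sum.delta) auto
  finally show ?thesis by (auto simp: Suc_le_eq)
qed

text \<open>The multiplicities of 1 to \<open>k\<close> add up to the count, and the subtracted
  constants to \<open>k + 1\<close>, because index 0 costs one unit more. For \<open>k = 0\<close>
  that extra unit is absent and the formula would give -1.\<close>

lemma sum_list_take_content_word:
  assumes "0 \<notin># M" "1 \<le> k" "k \<le> n"
  shows "sum_list (take k (content_word n M)) = int (count_upto M k) - int k - 1"
proof -
  have "sum_list (take k (content_word n M))
      = (\<Sum>j<k. int (count M (Suc j)) - (if j = 0 then 2 else 1))"
    using assms by (simp add: content_word_def take_map interv_sum_list_conv_sum_set_nat atLeast0LessThan)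
  also have "\<dots> = int (\<Sum>j<k. count M (Suc j)) - (\<Sum>j<k. (1 + (if j = 0 then 1 else 0)))"
    unfolding of_nat_sum sum_subtractf[symmetric] by (intro sum.cong) auto
  also have "(\<Sum>j<k. (1 + (if j = 0 then 1 else 0::int))) = int k + 1"
    using assms by (simp add: sum.distrib)
  finally show ?thesis using sum_count_eq_count_upto[OF assms(1)] by simp
qed

lemma content_word_in_luk_words:
  assumes "M \<in> prime_contents n" "1 \<le> n"
  shows "content_word n M \<in> luk_words n"
proof -
  have M: "size M = n + 1" "set_mset M \<subseteq> {1..n}" "\<forall>k\<in>{1..n}. k + 1 \<le> count_upto M k"
    using assms(1) by (auto simp: prime_contents_def)
  then have z: "0 \<notin># M" by auto
  note s = sum_list_take_content_word[OF z]
  have ge: "0 \<le> sum_list (take k (content_word n M))" if "k \<le> n" for k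
  proof (cases "k = 0")
    case False
    then have "k + 1 \<le> count_upto M k" using M(3) that by simp
    then show ?thesis using s[of k n] that False by simp
  qed simp
  have "- 1 \<le> x" if x: "x \<in> set (content_word n M)" for x
  proof -
    obtain j where j: "j < n" "x = content_word n M ! j"
      using x by (metis in_set_conv_nth length_content_word)
    show ?thesis
    proof (cases "j = 0")
      case True
      \<comment> \<open>A nonnegative multiplicity gives only -2 as a lower bound for the first
        letter; the better bound comes from the first height being nonnegative.\<close>
      have "sum_list (take 1 (content_word n M)) = x"
        using j True by (simp add: take_Suc_conv_app_nth)
      then show ?thesis using ge[of 1] assms(2) by simp
    next
      case False
      then show ?thesis using j by (simp add: content_word_nth)
    qed
  qed
  moreover have "sum_list (content_word n M) = 0"
  proof -
    have "count_upto M n = size M" using M(2) unfolding count_upto_eq_size_iff by auto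
    then show ?thesis using s[of n n] assms(2) M(1) by simp
  qed
  ultimately show ?thesis using ge by (simp add: luk_words_def)
qed

lemma word_content_content_word:
  assumes "M \<in> prime_contents n"
  shows "word_content (content_word n M) = M"
proof (rule multiset_eqI)
  fix x
  have "x \<notin> {1..n} \<Longrightarrow> count M x = 0"
    using assms by (auto simp: prime_contents_def count_eq_zero_iff)
  then show "count (word_content (content_word n M)) x = count M x"
    unfolding count_word_content by (auto simp: content_word_nth)
qed

lemma content_word_word_content:
  assumes "l \<in> luk_words n"
  shows "content_word n (word_content l) = l"
proof (rule nth_equalityI)
  show "length (content_word n (word_content l)) = length l"
    using assms by (simp add: luk_words_def)
  fix j assume "j < length (content_word n (word_content l))"
  then have j: "j < n" by simp
  have len: "length l = n" and "- 1 \<le> l ! j"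
    using assms j by (auto simp: luk_words_def)
  then show "content_word n (word_content l) ! j = l ! j"
    using j by (cases "j = 0") (auto simp: content_word_nth count_word_content)
qed

text \<open>Since \<open>content_word\<close> recovers \<open>l\<close>, the formula for its prefix
  sums applies to \<open>l\<close> itself and translates the path conditions into count
  conditions.\<close>

lemma word_content_in_prime_contents:
  assumes "l \<in> luk_words n" "1 \<le> n"
  shows "word_content l \<in> prime_contents n"
proof -
  have len: "length l = n" and ge: "\<And>k. k \<le> n \<Longrightarrow> 0 \<le> sum_list (take k l)" and tot: "sum_list l = 0"
    using assms(1) by (auto simp: luk_words_def)
  have sub: "set_mset (word_content l) \<subseteq> {1..n}"
    using len by (auto simp: count_word_content count_greater_zero_iff[symmetric]
        simp del: count_greater_zero_iff split: if_splits)
  then have z: "0 \<notin># word_content l" by auto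
  have s: "sum_list (take k l) = int (count_upto (word_content l) k) - int k - 1"
    if "1 \<le> k" "k \<le> n" for k
    using sum_list_take_content_word[OF z that] content_word_word_content[OF assms(1)] by simp
  have "count_upto (word_content l) n = size (word_content l)"
    using sub unfolding count_upto_eq_size_iff by auto
  then have "size (word_content l) = n + 1" using s[of n] tot len assms(2) by simp
  moreover have "k + 1 \<le> count_upto (word_content l) k" if "k \<in> {1..n}" for k
    using s[of k] ge[of k] that by simp
  ultimately show ?thesis using sub by (simp add: prime_contents_def)
qed

lemma bij_betw_content_word:
  assumes "1 \<le> n"
  shows "bij_betw (content_word n) (prime_contents n) (luk_words n)"
  by (rule bij_betw_byWitness[where f' = word_content])
    (use assms content_word_in_luk_words word_content_in_prime_contents
      word_content_content_word content_word_word_content in auto)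

section \<open>Displacement as a sum of heights\<close>

text \<open>Each count is the height plus \<open>k + 1\<close>, so double counting makes the entry
  sum, the height sum, n(n+1)/2 and n add up to (n+1)^2. Subtracting n(n+1)/2 leaves (n+1)(n+2)/2,
  the minuend of \<open>dis\<close>.\<close>

lemma dis_eq_sum_heights:
  assumes "mset \<pi> \<in> prime_contents n" "1 \<le> n"
  shows "dis \<pi> = n + (\<Sum>k=1..n. nat (sum_list (take k (content_word n (mset \<pi>)))))"
proof -
  let ?M = "mset \<pi>" and ?h = "\<lambda>k. nat (sum_list (take k (content_word n (mset \<pi>))))"
  have M: "size ?M = n + 1" "set_mset ?M \<subseteq> {1..n}" "\<forall>k\<in>{1..n}. k + 1 \<le> count_upto ?M k"
    using assms(1) by (auto simp: prime_contents_def)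
  then have z: "0 \<notin># ?M" by auto
  have "count_upto ?M k = ?h k + k + 1" if "k \<in> {1..n}" for k
    using sum_list_take_content_word[OF z, of k n] M(3) that by force
  then have "(\<Sum>k=1..n. count_upto ?M k) = (\<Sum>k=1..n. ?h k + k + 1)" by simp
  also have "\<dots> = (\<Sum>k=1..n. ?h k) + (\<Sum>k=1..n. k) + n"
    by (simp only: sum.distrib) simp
  finally have "sum_list \<pi> + ((\<Sum>k=1..n. ?h k) + (\<Sum>k=1..n. k) + n) = (n + 1) * (n + 1)"
    using sum_mset_plus_sum_count_upto[OF M(2)] M(1) by (simp add: sum_mset_sum_list)
  moreover have "2 * (\<Sum>k=1..n. k) = n * (n + 1)" by (induction n) auto
  moreover define T where "T = length \<pi> * (length \<pi> + 1) div 2"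
  moreover have "2 * T = (n + 1) * (n + 2)"
  proof -
    have "even ((n + 1) * (n + 2))" by simp
    then show ?thesis using M(1) by (simp add: T_def del: mult_Suc mult_Suc_right)
  qed
  ultimately have "2 * T = 2 * (sum_list \<pi> + (n + (\<Sum>k=1..n. ?h k)))"
    by (simp add: algebra_simps)
  \<comment> \<open>Written as a sum, the identity shows that the natural-number subtraction in
    \<open>dis\<close> is exact.\<close>
  then have "T = sum_list \<pi> + (n + (\<Sum>k=1..n. ?h k))" by simp
  then show ?thesis unfolding dis_def T_def[symmetric] by (simp only: add_diff_cancel_left')
qed

section \<open>Number of arrangements of a prime content\<close>

lemma card_permutations_prime_content:
  assumes "M \<in> prime_contents n" "1 \<le> n"
  shows "of_nat (card (permutations_of_multiset M)) =
    (fact (n + 1) * (1 / of_int (content_word n M ! 0 + 2) *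
      (\<Prod>j<n. 1 / fact (nat (content_word n M ! j + 1)))) :: 'a::field_char_0)"
proof -
  have M: "size M = n + 1" "set_mset M \<subseteq> {1..n}"
    using assms(1) by (auto simp: prime_contents_def)
  \<comment> \<open>Primality at \<open>k = 1\<close> gives two entries 1. Hence the first letter is
    nonnegative and the factor \<open>c\<close> can be split off from the factorial of
    \<open>c = count M 1\<close>.\<close>
  have c1: "2 \<le> count M 1"
  proof -
    have "0 \<notin># M" using M(2) by auto
    then have "count M 1 = count_upto M 1"
      using sum_count_eq_count_upto[of M 1] by simp
    moreover have "1 + 1 \<le> count_upto M 1"
      using assms unfolding prime_contents_def by fastforce
    ultimately show ?thesis by simp
  qed
  have w: "content_word n M ! 0 = int (count M 1) - 2"
    using assms(2) by (simp add: content_word_nth)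
  have f: "fact (count M 1) = (of_int (content_word n M ! 0 + 2) *
      fact (nat (content_word n M ! 0 + 1)) :: 'a)"
  proof -
    obtain c where "count M 1 = Suc (Suc c)" using c1 by (metis add_2_eq_Suc le_Suc_ex)
    then show ?thesis by (simp add: w nat_add_distrib)
  qed
  have lt: "{..<n} = insert 0 {1..<n}" using assms(2) by auto
  \<comment> \<open>Values in \<open>{1..n}\<close> that do not occur contribute 0! = 1.\<close>
  have "(\<Prod>x\<in>set_mset M. fact (count M x)) = (\<Prod>x=1..n. fact (count M x) :: nat)"
    using M(2) by (intro prod.mono_neutral_left) (auto simp: not_in_iff)
  also have "\<dots> = (\<Prod>j<n. fact (count M (Suc j)))"
    by (rule prod.reindex_bij_witness[of _ Suc "\<lambda>x. x - 1"]) auto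
  finally have "of_nat (\<Prod>x\<in>set_mset M. fact (count M x)) =
      (\<Prod>j<n. fact (count M (Suc j)) :: 'a)" by simp
  also have "\<dots> = fact (count M 1) * (\<Prod>j=1..<n. fact (count M (Suc j)))"
    unfolding lt by simp
  also have "(\<Prod>j=1..<n. fact (count M (Suc j))) =
      (\<Prod>j=1..<n. fact (nat (content_word n M ! j + 1)) :: 'a)"
    by (intro prod.cong) (auto simp: content_word_nth)
  also have "fact (count M 1) * \<dots> = of_int (content_word n M ! 0 + 2) *
      (\<Prod>j<n. fact (nat (content_word n M ! j + 1)) :: 'a)"
    unfolding lt f by (simp add: mult.assoc)
  finally have p: "of_nat (\<Prod>x\<in>set_mset M. fact (count M x)) =
      (of_int (content_word n M ! 0 + 2) *
      (\<Prod>j<n. fact (nat (content_word n M ! j + 1))) :: 'a)" .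
  have "card (permutations_of_multiset M) * (\<Prod>x\<in>set_mset M. fact (count M x)) = fact (n + 1)"
    using card_permutations_of_multiset_aux[of M] M(1) by simp
  then have "of_nat (card (permutations_of_multiset M)) *
      of_nat (\<Prod>x\<in>set_mset M. fact (count M x)) = (fact (n + 1) :: 'a)"
    by (metis of_nat_fact of_nat_mult)
  moreover have "of_nat (\<Prod>x\<in>set_mset M. fact (count M x)) \<noteq> (0 :: 'a)" by simp
  ultimately have "of_nat (card (permutations_of_multiset M)) =
      (fact (n + 1) / of_nat (\<Prod>x\<in>set_mset M. fact (count M x)) :: 'a)"
    by (simp only: eq_divide_eq) simp
  then show ?thesis unfolding p by (simp add: prod_dividef)
qed

section \<open>Summation over paths\<close>

lemma finite_PPF: "finite (PPF m)"
proof (rule finite_subset)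
  show "PPF m \<subseteq> {\<pi>. set \<pi> \<subseteq> {..m} \<and> length \<pi> = m}"
  proof
    fix \<pi> assume "\<pi> \<in> PPF m"
    then have p: "length \<pi> = m" "\<forall>i<m. sort \<pi> ! i \<le> Suc i"
      by (auto simp: PPF_def prime_parking_function_def parking_function_def)
    have "x \<le> m" if "x \<in> set \<pi>" for x
    proof -
      have "x \<in> set (sort \<pi>)" using that by simp
      then obtain i where i: "i < m" "sort \<pi> ! i = x"
        unfolding in_set_conv_nth using p(1) by auto
      then have "x \<le> Suc i" using p(2) by blast
      then show ?thesis using i(1) by simp
    qed
    then show "\<pi> \<in> {\<pi>. set \<pi> \<subseteq> {..m} \<and> length \<pi> = m}" using p by auto
  qed
qed (simp add: finite_lists_length_eq)

lemma inj_luk_path: "inj luk_path"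
  unfolding luk_path_def by (intro inj_mapI injI) auto

text \<open>Consecutive heights differ by one letter of \<open>l\<close>, so the factorials depend
  on the letters alone, while the powers of \<open>q\<close> collect the heights.\<close>

lemma prod_step_weight_luk_path:
  fixes q :: "'a::field_char_0"
  assumes "length l = n"
  shows "(\<Prod>j=1..n. step_weight q (height (luk_path l) (j - 1)) (height (luk_path l) j)) =
    q ^ (\<Sum>k=1..n. nat (sum_list (take k l))) * (\<Prod>j<n. 1 / fact (nat (l ! j + 1)))"
proof -
  have "step_weight q (height (luk_path l) (j - 1)) (height (luk_path l) j) =
      q ^ nat (sum_list (take j l)) * (1 / fact (nat (l ! (j - 1) + 1)))" if "j \<in> {1..n}" for j
  proof -
    have "j = Suc (j - 1)" "j - 1 < n" using that by auto
    then obtain i where i: "j = Suc i" "i < n" by blast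
    then show ?thesis
      using assms by (simp add: step_weight_def height_luk_path take_Suc_conv_app_nth)
  qed
  then have "(\<Prod>j=1..n. step_weight q (height (luk_path l) (j - 1)) (height (luk_path l) j)) =
      (\<Prod>j=1..n. q ^ nat (sum_list (take j l)) * (1 / fact (nat (l ! (j - 1) + 1))))"
    by (rule prod.cong[OF refl])
  also have "\<dots> = q ^ (\<Sum>k=1..n. nat (sum_list (take k l))) *
      (\<Prod>j=1..n. 1 / fact (nat (l ! (j - 1) + 1)))"
    by (simp only: prod.distrib power_sum)
  also have "(\<Prod>j=1..n. 1 / fact (nat (l ! (j - 1) + 1))) =
      (\<Prod>j<n. 1 / fact (nat (l ! j + 1)) :: 'a)"
    by (rule prod.reindex_bij_witness[of _ Suc "\<lambda>x. x - 1"]) auto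
  finally show ?thesis .
qed

text \<open>At \<open>n = 0\<close> the two sides differ: the left is 1, from \<open>[1]\<close>,
  whereas the empty path gives 1/2 on the right.\<close>

theorem theorem1p4:
  fixes q :: "'a::field_char_0" and n :: nat
  assumes "1 \<le> n"
  shows "PPF_enum (n + 1) q =
    fact (n + 1) * q ^ n *
      (\<Sum>p\<in>luk_paths n.
         1 / of_int (height p 1 - height p 0 + 2) *
         (\<Prod>j=1..n. step_weight q (height p (j - 1)) (height p j)))"
proof -
  define E where "E l = (\<Sum>k=1..n. nat (sum_list (take k l)))" for l :: "int list"
  define F :: "int list \<Rightarrow> 'a" where
    "F l = 1 / of_int (l ! 0 + 2) * (\<Prod>j<n. 1 / fact (nat (l ! j + 1)))" for l
  have img: "mset ` PPF (n + 1) = prime_contents n"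
  proof
    show "prime_contents n \<subseteq> mset ` PPF (n + 1)"
    proof
      fix M assume M: "M \<in> prime_contents n"
      obtain \<pi> where "mset \<pi> = M" using ex_mset by blast
      then show "M \<in> mset ` PPF (n + 1)" using M PPF_iff_prime_contents[OF assms] by blast
    qed
  qed (use PPF_iff_prime_contents[OF assms] in auto)
  \<comment> \<open>The fibre over a content consists of all its arrangements, and they share one
    displacement, so its sum is their number times a single power of \<open>q\<close>.\<close>
  have fibre: "(\<Sum>\<pi>\<in>{\<pi> \<in> PPF (n + 1). mset \<pi> = M}. q ^ dis \<pi>) =
      fact (n + 1) * q ^ n * (q ^ E (content_word n M) * F (content_word n M))"
    if M: "M \<in> prime_contents n" for M
  proof -
    have "{\<pi> \<in> PPF (n + 1). mset \<pi> = M} = permutations_of_multiset M"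
      using M PPF_iff_prime_contents[OF assms] by (auto simp: permutations_of_multiset_def)
    moreover have "q ^ dis \<pi> = q ^ (n + E (content_word n M))"
      if "\<pi> \<in> permutations_of_multiset M" for \<pi>
      using dis_eq_sum_heights[of \<pi> n] M that assms by (auto simp: permutations_of_multiset_def E_def)
    ultimately have "(\<Sum>\<pi>\<in>{\<pi> \<in> PPF (n + 1). mset \<pi> = M}. q ^ dis \<pi>) =
        of_nat (card (permutations_of_multiset M)) * q ^ (n + E (content_word n M))"
      by simp
    also have "\<dots> = fact (n + 1) * F (content_word n M) * q ^ (n + E (content_word n M))"
      unfolding card_permutations_prime_content[OF M assms] F_def ..
    finally show ?thesis by (simp only: power_add mult_ac)
  qed
  have "PPF_enum (n + 1) q =
      (\<Sum>M\<in>prime_contents n. \<Sum>\<pi>\<in>{\<pi> \<in> PPF (n + 1). mset \<pi> = M}. q ^ dis \<pi>)"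
    unfolding PPF_enum_def img[symmetric] by (rule sum.image_gen[OF finite_PPF])
  also have "\<dots> = fact (n + 1) * q ^ n *
      (\<Sum>M\<in>prime_contents n. q ^ E (content_word n M) * F (content_word n M))"
    unfolding sum_distrib_left by (rule sum.cong[OF refl fibre])
  also have "(\<Sum>M\<in>prime_contents n. q ^ E (content_word n M) * F (content_word n M)) =
      (\<Sum>l\<in>luk_words n. q ^ E l * F l)"
    by (rule sum.reindex_bij_betw[OF bij_betw_content_word[OF assms]])
  also have "\<dots> = (\<Sum>p\<in>luk_paths n.
         1 / of_int (height p 1 - height p 0 + 2) *
         (\<Prod>j=1..n. step_weight q (height p (j - 1)) (height p j)))"
    unfolding luk_paths_def
  \<comment> \<open>A step determines its letter through its second coordinate, so summing over
    paths is the same as summing over words.\<close>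
  proof (subst sum.reindex[OF inj_on_subset[OF inj_luk_path subset_UNIV]], rule sum.cong[OF refl])
    fix l assume "l \<in> luk_words n"
    then have len: "length l = n" by (simp add: luk_words_def)
    then have "take 1 l = [l ! 0]" using assms by (cases l) auto
    then have "height (luk_path l) 1 - height (luk_path l) 0 = l ! 0"
      by (simp add: height_luk_path)
    then show "q ^ E l * F l =
      ((\<lambda>p. 1 / of_int (height p 1 - height p 0 + 2) *
         (\<Prod>j=1..n. step_weight q (height p (j - 1)) (height p j))) \<circ> luk_path) l"
      unfolding o_apply prod_step_weight_luk_path[OF len] E_def F_def by (simp only: mult_ac)
  qed
  finally show ?thesis .
qed

end
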